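(* Let $N$ be an even positive integer and $p<q$ relatively prime positive integers. Write $\frac qp=a_1+\cfrac{1}{a_2+\cdots+\cfrac{1}{a_n}}$ with integers $a_k\ge1$, set $(p_0,q_0)=(0,1)$ and for $1\le k\le n$ let $q_k/p_k$ (coprime, positive) be the truncation $a_1+\cfrac{1}{a_2+\cdots+\cfrac1{a_k}}$. Then $$N!\,\beta_N r_N\,\mathrm{Td}^N_{pq}(x,y)-\alpha_Nr_N(x+py)^{N-1}x-\alpha_Nr_N\big((-1)^{n-1}q_{n-1}x+y\big)^{N-1}y\in q\,\mathbb Z[x,y].$$
   Context: $\mathrm{Td}_{pq}$ is the Todd series of the lattice cone generated by $v_1=(1,0)$, $v_2=(p,q)$: with $\Gamma=\mathbb Z^2/(\mathbb Zv_1+\mathbb Zv_2)$, writing $g=a_1(g)v_1+a_2(g)v_2$ with rational $a_i(g)$ and $\chi_i(\gamma)=\exp(2\pi i\,a_i(g))$, $\mathrm{Td}_{pq}(x,y)=\sum_{\gamma\in\Gamma}\frac{x}{1-\chi_1(\gamma)e^{-x}}\frac{y}{1-\chi_2(\gamma)e^{-y}}$ as a power series at $0$ (rational coefficients); $\mathrm{Td}^N_{pq}$ is its homogeneous part of degree $N$. Bernoulli numbers: $\frac{z}{e^z-1}=\sum_k\frac{B_k}{k!}z^k$. $B_N=\alpha_N/\beta_N$ in lowest terms, $\beta_N>0$. $r_N$ is the lcm of the denominators of $\beta_N\binom{N}{i+1}B_{i+1}B_{N-i-1}$ over odd $i$ with $0\le i\le N-2$ (empty lcm $=1$). *)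

theory Defs
  imports Complex_Main "HOL-Computational_Algebra.Computational_Algebra"
begin

definition bernoulli :: "nat \<Rightarrow> rat" where
  "bernoulli k = fact k * fps_nth (fps_X / (fps_exp 1 - 1)) k"

definition rat_num :: "rat \<Rightarrow> int" where
  "rat_num x = fst (quotient_of x)"

definition rat_den :: "rat \<Rightarrow> int" where
  "rat_den x = snd (quotient_of x)"

definition bern_num :: "nat \<Rightarrow> int" where
  "bern_num N = rat_num (bernoulli N)"

definition bern_den :: "nat \<Rightarrow> int" where
  "bern_den N = rat_den (bernoulli N)"

definition bern_lcm :: "nat \<Rightarrow> int" where
  "bern_lcm N =
     Lcm ((\<lambda>i. rat_den (of_int (bern_den N) * of_nat (N choose (i + 1))
                          * bernoulli (i + 1) * bernoulli (N - i - 1)))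
          ` {i. odd i \<and> i + 2 \<le> N})"

definition cone_lattice_rel :: "int \<times> int \<Rightarrow> int \<times> int \<Rightarrow> ((int \<times> int) \<times> (int \<times> int)) set" where
  "cone_lattice_rel v1 v2 =
     {(g, h). \<exists>m n :: int. fst g - fst h = m * fst v1 + n * fst v2 \<and>
                           snd g - snd h = m * snd v1 + n * snd v2}"

definition cone_group :: "int \<times> int \<Rightarrow> int \<times> int \<Rightarrow> (int \<times> int) set set" where
  "cone_group v1 v2 = UNIV // cone_lattice_rel v1 v2"

definition cone_coords :: "int \<times> int \<Rightarrow> int \<times> int \<Rightarrow> int \<times> int \<Rightarrow> rat \<times> rat" where
  "cone_coords v1 v2 g =
     (THE a. of_int (fst g) = fst a * of_int (fst v1) + snd a * of_int (fst v2) \<and>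
             of_int (snd g) = fst a * of_int (snd v1) + snd a * of_int (snd v2))"

text \<open>The characters of the quotient group, evaluated at an arbitrary representative of the
  class; independence of the choice is \<open>cone_chi_class\<close> below.\<close>

definition cone_chi1 :: "int \<times> int \<Rightarrow> int \<times> int \<Rightarrow> (int \<times> int) set \<Rightarrow> complex" where
  "cone_chi1 v1 v2 \<gamma> = exp (2 * of_real pi * \<i> * of_rat (fst (cone_coords v1 v2 (SOME g. g \<in> \<gamma>))))"

definition cone_chi2 :: "int \<times> int \<Rightarrow> int \<times> int \<Rightarrow> (int \<times> int) set \<Rightarrow> complex" where
  "cone_chi2 v1 v2 \<gamma> = exp (2 * of_real pi * \<i> * of_rat (snd (cone_coords v1 v2 (SOME g. g \<in> \<gamma>))))"

text \<open>The expansion at 0 of \<open>z / (1 - c * exp (-z))\<close>. For \<open>c = 1\<close> the denominator has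
  subdegree 1, and the division cancels the common factor \<open>z\<close>.\<close>

definition todd_factor :: "complex \<Rightarrow> complex fps" where
  "todd_factor c = fps_X / (1 - fps_const c * fps_exp (-1))"

text \<open>Power series and polynomials in \<open>x, y\<close> are nested: the outer variable is \<open>y\<close> and the
  coefficients are series or polynomials in \<open>x\<close>. So the coefficient of \<open>x^i * y^j\<close> in
  \<open>F\<close> is \<open>F $ j $ i\<close>.\<close>

definition series_in_x :: "complex fps \<Rightarrow> complex fps fps" where
  "series_in_x f = fps_const f"

definition series_in_y :: "complex fps \<Rightarrow> complex fps fps" where
  "series_in_y f = Abs_fps (\<lambda>j. fps_const (fps_nth f j))"

definition cone_todd :: "int \<times> int \<Rightarrow> int \<times> int \<Rightarrow> complex fps fps" where
  "cone_todd v1 v2 =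
     (\<Sum>\<gamma>\<in>cone_group v1 v2. series_in_x (todd_factor (cone_chi1 v1 v2 \<gamma>))
                               * series_in_y (todd_factor (cone_chi2 v1 v2 \<gamma>)))"

definition Td :: "int \<Rightarrow> int \<Rightarrow> complex fps fps" where
  "Td p q = cone_todd (1, 0) (p, q)"

definition homogeneous_part :: "nat \<Rightarrow> complex fps fps \<Rightarrow> complex poly poly" where
  "homogeneous_part N F =
     (\<Sum>i\<le>N. monom (monom (fps_nth (fps_nth F (N - i)) i) i) (N - i))"

definition var_x :: "complex poly poly" where
  "var_x = [:[:0, 1:]:]"

definition var_y :: "complex poly poly" where
  "var_y = [:0, 1:]"

definition int_polys_xy :: "complex poly poly set" where
  "int_polys_xy = {P. \<forall>i j. poly.coeff (poly.coeff P j) i \<in> \<int>}"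

fun cont_frac :: "int list \<Rightarrow> rat" where
  "cont_frac [] = 0"
| "cont_frac [a] = of_int a"
| "cont_frac (a # b # as) = of_int a + 1 / cont_frac (b # as)"


lemma cone_coords_eqI:
  assumes det: "fst v1 * snd v2 \<noteq> snd v1 * fst v2"
    and a: "of_int (fst g) = a1 * of_int (fst v1) + a2 * of_int (fst v2)"
           "of_int (snd g) = a1 * of_int (snd v1) + a2 * of_int (snd v2)"
  shows "cone_coords v1 v2 g = (a1, a2)"
  unfolding cone_coords_def
proof (rule the_equality)
  show "of_int (fst g) = fst (a1, a2) * of_int (fst v1) + snd (a1, a2) * of_int (fst v2) \<and>
        of_int (snd g) = fst (a1, a2) * of_int (snd v1) + snd (a1, a2) * of_int (snd v2)"
    using a by simp
next
  fix b :: "rat \<times> rat"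
  assume b: "of_int (fst g) = fst b * of_int (fst v1) + snd b * of_int (fst v2) \<and>
             of_int (snd g) = fst b * of_int (snd v1) + snd b * of_int (snd v2)"
  define D :: rat where "D = of_int (fst v1) * of_int (snd v2) - of_int (snd v1) * of_int (fst v2)"
  have "D = of_int (fst v1 * snd v2 - snd v1 * fst v2)"
    by (simp add: D_def)
  hence D: "D \<noteq> 0"
    using det by (simp only: of_int_eq_0_iff)
  have "fst b * D = of_int (fst g) * of_int (snd v2) - of_int (snd g) * of_int (fst v2)"
    using b by (simp add: D_def algebra_simps)
  moreover have "a1 * D = of_int (fst g) * of_int (snd v2) - of_int (snd g) * of_int (fst v2)"
    by (simp add: a D_def algebra_simps)
  moreover have "snd b * D = of_int (snd g) * of_int (fst v1) - of_int (fst g) * of_int (snd v1)"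
    using b by (simp add: D_def algebra_simps)
  moreover have "a2 * D = of_int (snd g) * of_int (fst v1) - of_int (fst g) * of_int (snd v1)"
    by (simp add: a D_def algebra_simps)
  ultimately have "fst b = a1" "snd b = a2"
    using D by (metis mult_cancel_right)+
  thus "b = (a1, a2)"
    by (simp add: prod_eq_iff)
qed

lemma cone_coords_pq:
  assumes "q \<noteq> 0"
  shows "cone_coords (1, 0) (p, q) g =
           (of_int (fst g) - of_int p * of_int (snd g) / of_int q, of_int (snd g) / of_int q)"
  using assms by (intro cone_coords_eqI) (auto simp: field_simps)

lemma equiv_cone_lattice_rel: "equiv UNIV (cone_lattice_rel v1 v2)"
proof (rule equivI)
  show "refl_on UNIV (cone_lattice_rel v1 v2)"
    by (auto simp: refl_on_def cone_lattice_rel_def intro!: exI[of _ 0])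
  show "sym (cone_lattice_rel v1 v2)"
  proof (rule symI)
    fix g h assume "(g, h) \<in> cone_lattice_rel v1 v2"
    then obtain m n where "fst g - fst h = m * fst v1 + n * fst v2"
        "snd g - snd h = m * snd v1 + n * snd v2"
      by (auto simp: cone_lattice_rel_def)
    thus "(h, g) \<in> cone_lattice_rel v1 v2"
      unfolding cone_lattice_rel_def mem_Collect_eq case_prod_conv
      by (intro exI[where x = "-m"] exI[where x = "-n"]) simp
  qed
  show "trans (cone_lattice_rel v1 v2)"
  proof (rule transI)
    fix g h k assume "(g, h) \<in> cone_lattice_rel v1 v2" "(h, k) \<in> cone_lattice_rel v1 v2"
    then obtain m n m' n' where "fst g - fst h = m * fst v1 + n * fst v2"
        "snd g - snd h = m * snd v1 + n * snd v2" "fst h - fst k = m' * fst v1 + n' * fst v2"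
        "snd h - snd k = m' * snd v1 + n' * snd v2"
      by (auto simp: cone_lattice_rel_def)
    thus "(g, k) \<in> cone_lattice_rel v1 v2"
      unfolding cone_lattice_rel_def mem_Collect_eq case_prod_conv
      by (intro exI[where x = "m + m'"] exI[where x = "n + n'"]) (simp add: algebra_simps)
  qed
qed auto

lemma exp_2pi_shift_int:
  "exp (2 * of_real pi * \<i> * of_rat (a + of_int m)) = exp (2 * of_real pi * \<i> * of_rat a :: complex)"
proof -
  have "exp (2 * of_real pi * \<i> * of_rat (a + of_int m)) =
        exp (2 * of_real pi * \<i> * of_rat a) * (exp (\<i> * (of_int m * (of_real pi * 2))) :: complex)"
    by (simp add: of_rat_add exp_add[symmetric] algebra_simps)
  also have "exp (\<i> * (of_int m * (of_real pi * 2))) = (1 :: complex)"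
    using cis_multiple_2pi[of "of_int m"] by (simp add: cis_conv_exp algebra_simps)
  finally show ?thesis by simp
qed

lemma cone_chi_class:
  assumes q: "q \<noteq> 0" and \<gamma>: "\<gamma> \<in> cone_group (1, 0) (p, q)" and g: "g \<in> \<gamma>"
  shows "cone_chi1 (1, 0) (p, q) \<gamma> =
           exp (2 * of_real pi * \<i> * of_rat (fst (cone_coords (1, 0) (p, q) g)))"
    and "cone_chi2 (1, 0) (p, q) \<gamma> =
           exp (2 * of_real pi * \<i> * of_rat (snd (cone_coords (1, 0) (p, q) g)))"
proof -
  define h where "h = (SOME h. h \<in> \<gamma>)"
  have "h \<in> \<gamma>" unfolding h_def using g by (rule someI)
  hence "(h, g) \<in> cone_lattice_rel (1, 0) (p, q)"
    using \<gamma> g quotient_eq_iff[OF equiv_cone_lattice_rel] unfolding cone_group_def by blast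
  then obtain m n where mn: "fst h = fst g + m + n * p" "snd h = snd g + n * q"
    by (auto simp: cone_lattice_rel_def algebra_simps)
  have "cone_coords (1, 0) (p, q) h =
          (fst (cone_coords (1, 0) (p, q) g) + of_int m, snd (cone_coords (1, 0) (p, q) g) + of_int n)"
    using q by (simp add: cone_coords_pq mn field_simps)
  thus "cone_chi1 (1, 0) (p, q) \<gamma> =
           exp (2 * of_real pi * \<i> * of_rat (fst (cone_coords (1, 0) (p, q) g)))"
    and "cone_chi2 (1, 0) (p, q) \<gamma> =
           exp (2 * of_real pi * \<i> * of_rat (snd (cone_coords (1, 0) (p, q) g)))"
    unfolding cone_chi1_def cone_chi2_def h_def[symmetric] by (simp_all only: fst_conv snd_conv exp_2pi_shift_int)
qed

end

theory Submission
  imports Defs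
begin

text \<open>Restricting to the line \<open>t \<mapsto> (x t, y t)\<close> turns the Todd series into a power series in one
  variable, equal to \<open>q x y t\<^sup>2\<close> times the generating function of the points \<open>(r, s)\<close> of the
  quadrant with \<open>s \<equiv> p r (mod q)\<close>. Cutting the quadrant along the ray through \<open>(1, p)\<close> gives one
  unimodular cone and a cone of index \<open>p\<close> with parameters \<open>(-q, p)\<close>, so one can induct on \<open>q\<close>.
  In degree \<open>N\<close>, the unimodular piece contributes products \<open>B\<^sub>i B\<^sub>N\<^sub>-\<^sub>i\<close>, which
  \<open>\<beta>\<^sub>N r\<^sub>N\<close> makes integral, and two extreme terms with coefficient \<open>B\<^sub>N\<close>. As \<open>N - 1\<close> is
  odd, the extreme terms at the new ray cancel, and only those at the two boundary rays survive;
  these are the two explicit terms of the theorem, because \<open>(-1)\<^sup>n\<^sup>-\<^sup>1 q\<^sub>n\<^sub>-\<^sub>1\<close> is inverse to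
  \<open>p\<close> modulo \<open>q\<close>.\<close>

section \<open>Continued fractions\<close>

text \<open>The empty list stands for 1/0, the pair \<open>(qs 0, ps 0)\<close>, so that the
  determinant identity below also covers lists of length one.\<close>

fun cf_num_den :: "int list \<Rightarrow> int \<times> int" where
  "cf_num_den [] = (1, 0)"
| "cf_num_den (a # as) = (a * fst (cf_num_den as) + snd (cf_num_den as), fst (cf_num_den as))"

lemma cf_num_den_pos:
  assumes "\<forall>a\<in>set as. a \<ge> 1"
  shows "fst (cf_num_den as) > 0 \<and> snd (cf_num_den as) \<ge> 0"
  using assms
proof (induction as)
  case (Cons a as)
  then have "a * fst (cf_num_den as) > 0" by (intro mult_pos_pos) auto
  with Cons show ?case by (auto intro: add_pos_nonneg)
qed simp

lemma coprime_cf_num_den: "coprime (fst (cf_num_den as)) (snd (cf_num_den as))"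
proof (induction as)
  case (Cons a as)
  moreover have "gcd (fst (cf_num_den as)) (a * fst (cf_num_den as) + snd (cf_num_den as))
      = gcd (fst (cf_num_den as)) (snd (cf_num_den as))"
    by (rule gcd_add_mult)
  ultimately show ?case by (simp add: coprime_iff_gcd_eq_1 gcd.commute)
qed simp

lemma cont_frac_eq_cf_num_den:
  assumes "\<forall>a\<in>set as. a \<ge> 1" "as \<noteq> []"
  shows "cont_frac as = of_int (fst (cf_num_den as)) / of_int (snd (cf_num_den as))"
  using assms
proof (induction as rule: cont_frac.induct)
  case (3 a b as)
  then have "fst (cf_num_den (b # as)) > 0" by (metis cf_num_den_pos list.set_intros(2))
  then have "fst (cf_num_den (b # as)) \<noteq> 0" by linarith
  then have "(of_int (fst (cf_num_den (b # as))) :: rat) \<noteq> 0" by (simp only: of_int_eq_0_iff not_False_eq_True)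
  moreover have "cont_frac (b # as) = of_int (fst (cf_num_den (b # as))) / of_int (snd (cf_num_den (b # as)))"
    using 3 by auto
  ultimately show ?case
    by (simp only: cont_frac.simps cf_num_den.simps(2)[of a] fst_conv snd_conv of_int_add of_int_mult)
       (simp add: add_divide_distrib del: cf_num_den.simps)
qed auto

text \<open>Prefixing an entry multiplies the matrix of the two pairs by one of determinant -1. Read
  modulo the numerator, the identity provides the inverse of the denominator up to sign.\<close>

lemma cf_num_den_det:
  assumes "as \<noteq> []"
  shows "fst (cf_num_den as) * snd (cf_num_den (butlast as))
       - snd (cf_num_den as) * fst (cf_num_den (butlast as)) = (-1) ^ length as"
  using assms
proof (induction as)
  case (Cons a as)
  show ?case
  proof (cases "as = []")
    case False
    with Cons have IH: "fst (cf_num_den as) * snd (cf_num_den (butlast as))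
       - snd (cf_num_den as) * fst (cf_num_den (butlast as)) = (-1) ^ length as" by simp
    show ?thesis using False by (simp add: algebra_simps flip: IH)
  qed simp
qed simp

lemma quotient_of_coprime:
  assumes "b > 0" "coprime a b"
  shows "quotient_of (of_int a / of_int b) = (a, b)"
  using assms by (simp add: quotient_of_Fract flip: Rat.Fract_of_int_quotient)

lemma coprime_fraction_unique:
  fixes a b c d :: int
  assumes "coprime a b" "coprime c d" "b > 0" "d > 0"
    and "(of_int a / of_int b :: rat) = of_int c / of_int d"
  shows "a = c" "b = d"
proof -
  have "(a, b) = (c, d)"
    using assms(5) quotient_of_coprime[OF assms(3,1)] quotient_of_coprime[OF assms(4,2)] by metis
  then show "a = c" "b = d" by simp_all
qed

lemma convergent_eq_cf_num_den:
  assumes "\<forall>a\<in>set as. a \<ge> 1" "as \<noteq> []" "p > 0" "coprime p q"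
    and "(of_int q / of_int p :: rat) = cont_frac as"
  shows "cf_num_den as = (q, p)"
proof -
  have "snd (cf_num_den as) > 0"
    using assms(1,2) cf_num_den_pos[of "tl as"] by (cases as) auto
  then have "q = fst (cf_num_den as)" "p = snd (cf_num_den as)"
    using coprime_fraction_unique[of q p "fst (cf_num_den as)" "snd (cf_num_den as)"]
      assms cont_frac_eq_cf_num_den[of as] coprime_cf_num_den[of as]
    by (auto simp: coprime_commute)
  then show ?thesis by simp
qed

section \<open>Bernoulli numbers\<close>

text \<open>For \<open>c = 1\<close> the denominator has order 1 and divides \<open>fps_X\<close>;
  otherwise its constant term \<open>1 - c\<close> makes it a unit. Later arguments use this
  equation in place of the quotient.\<close>

lemma todd_factor_mult: "todd_factor c * (1 - fps_const c * fps_exp (-1)) = fps_X"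
proof (cases "c = 1")
  case True
  let ?f = "1 - fps_exp (-1) :: complex fps"
  have "subdegree ?f = 1" by (rule subdegreeI) auto
  then show ?thesis using True by (simp add: todd_factor_def fps_dvd_iff)
next
  case False
  then have "(1 - fps_const c * fps_exp (-1)) $ 0 \<noteq> 0" by simp
  then show ?thesis by (simp add: todd_factor_def fps_divide_unit mult.assoc inverse_mult_eq_1)
qed

definition bernoulli_fps :: "rat fps" where "bernoulli_fps = fps_X / (fps_exp 1 - 1)"

lemma bernoulli_fps_mult: "bernoulli_fps * (fps_exp 1 - 1) = fps_X"
proof -
  have "subdegree (fps_exp 1 - 1 :: rat fps) = 1" by (rule subdegreeI) auto
  then show ?thesis by (simp add: bernoulli_fps_def fps_dvd_iff)
qed

lemma nth_bernoulli_fps: "bernoulli_fps $ k = bernoulli k / fact k"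
  by (simp add: bernoulli_fps_def bernoulli_def)

text \<open>With b(z) = z/(e^z - 1) one has b(-z) = z e^z/(e^z - 1) = z + b(z); the calculation
  clears denominators and cancels.\<close>

lemma bernoulli_fps_reflect:
  "Abs_fps (\<lambda>n. (-1) ^ n * bernoulli_fps $ n) = fps_X + bernoulli_fps"
proof -
  let ?g = "Abs_fps (\<lambda>n. (-1) ^ n * bernoulli_fps $ n)"
  let ?m = "fps_const (-1) * fps_X :: rat fps"
  have g: "?g = bernoulli_fps oo ?m" by (simp add: fps_compose_linear)
  have "(bernoulli_fps * (fps_exp 1 - 1)) oo ?m = fps_X oo ?m" by (simp add: bernoulli_fps_mult)
  then have "?g * (fps_exp (-1) - 1) = - fps_X"
    by (simp add: g fps_compose_mult_distrib fps_compose_sub_distrib fps_exp_compose_linear del: fps_const_neg flip: fps_const_neg)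
  then have "?g * (fps_exp (-1) - 1) * fps_exp 1 = - fps_X * fps_exp 1" by simp
  moreover have "(fps_exp (-1) - 1) * fps_exp 1 = (1 - fps_exp 1 :: rat fps)"
    by (simp add: algebra_simps flip: fps_exp_add_mult)
  ultimately have "?g * (1 - fps_exp 1) = - fps_X * fps_exp 1" by (simp only: mult.assoc)
  then have "?g * (fps_exp 1 - 1) = (fps_X + bernoulli_fps) * (fps_exp 1 - 1)"
    by (simp add: algebra_simps flip: bernoulli_fps_mult)
  moreover have "(fps_exp 1 - 1 :: rat fps) $ 1 \<noteq> 0" by simp
  then have "(fps_exp 1 - 1 :: rat fps) \<noteq> 0" by force
  ultimately show ?thesis by simp
qed

lemma bernoulli_reflect: "(-1) ^ k * bernoulli k = bernoulli k + (if k = 1 then 1 else 0)"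
proof -
  have "(-1) ^ k * bernoulli_fps $ k = (fps_X + bernoulli_fps) $ k"
    using arg_cong[OF bernoulli_fps_reflect, of "\<lambda>f. f $ k"] by simp
  then show ?thesis by (auto simp: nth_bernoulli_fps field_simps split: if_splits)
qed

lemma bernoulli_odd: "odd k \<Longrightarrow> k \<noteq> 1 \<Longrightarrow> bernoulli k = 0"
  using bernoulli_reflect[of k] by simp

lemma bernoulli_1: "bernoulli 1 = - 1 / 2"
  using bernoulli_reflect[of 1] by simp

lemma bernoulli_0: "bernoulli 0 = 1"
  using arg_cong[OF bernoulli_fps_mult, of "\<lambda>f. f $ 1"]
  by (simp add: fps_mult_nth nth_bernoulli_fps)

lemma bernoulli_2: "bernoulli 2 = 1 / 6"
  using arg_cong[OF bernoulli_fps_mult, of "\<lambda>f. f $ 3"]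
  by (simp add: fps_mult_nth nth_bernoulli_fps bernoulli_0 bernoulli_1[simplified] eval_nat_numeral field_simps)

lemma of_rat_fact: "of_rat (fact n) = fact n"
  by (metis of_nat_fact of_rat_of_nat_eq)

text \<open>The function z/(1 - e^(-z)) is z/(e^z - 1) with z replaced by -z. Both sides have the
  same product with the nonzero series 1 - e^(-z).\<close>

lemma nth_todd_factor_1: "todd_factor 1 $ k = (-1) ^ k * of_rat (bernoulli k) / fact k"
proof -
  let ?g = "Abs_fps (\<lambda>n. (-1) ^ n * of_rat (bernoulli_fps $ n)) :: complex fps"
  have "?g * (1 - fps_exp (-1)) = fps_X"
  proof (rule fps_ext)
    fix n
    have "(?g * (1 - fps_exp (-1))) $ n =
          - ((-1) ^ n * of_rat ((bernoulli_fps * (fps_exp 1 - 1)) $ n))"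
      unfolding fps_mult_nth of_rat_sum sum_distrib_left sum_negf[symmetric]
    proof (intro sum.cong refl)
      fix i assume "i \<in> {0..n}"
      then have "(-1 :: complex) ^ n = (-1) ^ i * (-1) ^ (n - i)" by (simp flip: power_add)
      then show "?g $ i * (1 - fps_exp (-1)) $ (n - i) =
          - ((-1) ^ n * of_rat (bernoulli_fps $ i * (fps_exp 1 - 1) $ (n - i)))"
        by (auto simp: of_rat_mult of_rat_diff of_rat_divide of_rat_power
            of_rat_fact mult_ac)
    qed
    then show "(?g * (1 - fps_exp (-1))) $ n = fps_X $ n"
      by (simp add: bernoulli_fps_mult)
  qed
  moreover have "(1 - fps_exp (-1) :: complex fps) $ 1 \<noteq> 0" by simp
  then have "(1 - fps_exp (-1) :: complex fps) \<noteq> 0" by force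
  moreover have "todd_factor 1 * (1 - fps_exp (-1)) = fps_X"
    using todd_factor_mult[of 1] by simp
  ultimately have "todd_factor 1 = ?g" by (metis mult_right_cancel)
  then show ?thesis by (simp add: nth_bernoulli_fps of_rat_divide of_rat_fact)
qed

section \<open>Denominators and integrality of the Todd coefficients\<close>

lemma rat_den_pos: "rat_den z > 0"
  by (simp add: rat_den_def quotient_of_denom_pos')

lemma rat_num_den: "z = of_int (rat_num z) / of_int (rat_den z)"
  unfolding rat_num_def rat_den_def by (rule quotient_of_div) simp

lemma rat_den_dvd_imp_Ints:
  assumes "rat_den z dvd m"
  shows "of_int m * z \<in> \<int>"
proof -
  obtain k where "m = rat_den z * k" using assms by auto
  then have "of_int m * z = of_int (k * rat_num z)"
    using rat_den_pos[of z] by (subst rat_num_den[of z]) simp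
  then show ?thesis by (metis Ints_of_int)
qed

lemma bern_den_mult_bernoulli: "of_int (bern_den N) * bernoulli N = of_int (bern_num N)"
  using rat_den_pos[of "bernoulli N"]
  by (subst rat_num_den[of "bernoulli N"]) (simp add: bern_den_def bern_num_def)

lemma bern_den_2: "bern_den 2 = 6"
  using quotient_of_coprime[of 6 1] by (simp add: bern_den_def bernoulli_2 rat_den_def)

text \<open>An even \<open>i\<close> corresponds to the odd index \<open>i - 1\<close> in
  \<open>bern_lcm\<close>. For odd \<open>i\<close> both Bernoulli indices are odd and a factor
  vanishes, except in the product B_1 B_1.\<close>

lemma bern_lcm_integral:
  assumes "even N" "0 < i" "i < N"
  shows "of_int (bern_den N * bern_lcm N) * of_nat (N choose i) * bernoulli i * bernoulli (N - i) \<in> \<int>"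
proof (cases "even i")
  case True
  define z where "z = of_int (bern_den N) * of_nat (N choose i) * bernoulli i * bernoulli (N - i)"
  have "i - 1 \<in> {i. odd i \<and> i + 2 \<le> N}" using True assms by auto
  then have "rat_den z dvd bern_lcm N"
    unfolding bern_lcm_def z_def using assms
    by (intro dvd_Lcm image_eqI[of _ _ "i - 1"]) auto
  then have "of_int (bern_lcm N) * z \<in> \<int>" by (rule rat_den_dvd_imp_Ints)
  then show ?thesis by (simp add: z_def mult_ac)
next
  case False
  show ?thesis
  proof (cases "N = 2")
    case True
    \<comment> \<open>The value is \<open>bern_lcm 2\<close> times 6 * 2 * (1/4) = 3.\<close>
    then have "i = 1" using assms by auto
    then show ?thesis using True by (simp add: bern_den_2 bernoulli_1[simplified])
  next
    case F: False
    then have "i \<noteq> 1 \<or> N - i \<noteq> 1" by auto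
    moreover have "odd (N - i)" using assms False by auto
    ultimately have "bernoulli i = 0 \<or> bernoulli (N - i) = 0"
      using False bernoulli_odd by blast
    then show ?thesis by auto
  qed
qed

lemma todd_coeff_integral:
  assumes "even N" "0 < i" "i < N"
  shows "fact N * of_int (bern_den N * bern_lcm N) * todd_factor 1 $ i * todd_factor 1 $ (N - i) \<in> \<int>"
proof -
  obtain m where m: "of_int (bern_den N * bern_lcm N) * of_nat (N choose i) * bernoulli i * bernoulli (N - i) = of_int m"
    using bern_lcm_integral[OF assms] by (auto elim: Ints_cases)
  have "(-1 :: complex) ^ i * (-1) ^ (N - i) = 1" using assms by (simp flip: power_add)
  then have s: "todd_factor 1 $ i * todd_factor 1 $ (N - i)
     = of_rat (bernoulli i * bernoulli (N - i)) / (fact i * fact (N - i))"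
    by (simp add: nth_todd_factor_1 of_rat_mult)
  have "(fact N :: complex) / (fact i * fact (N - i)) = of_nat (N choose i)"
    using assms by (simp add: binomial_fact)
  then have "fact N * of_int (bern_den N * bern_lcm N) * (todd_factor 1 $ i * todd_factor 1 $ (N - i))
      = of_int (bern_den N * bern_lcm N) * of_nat (N choose i) * of_rat (bernoulli i * bernoulli (N - i))"
    unfolding s by (simp add: field_simps)
  also have "\<dots> = of_rat (of_int m)" unfolding m[symmetric] by (simp add: of_rat_mult mult_ac)
  finally show ?thesis by (simp add: mult.assoc)
qed

lemma todd_coeff_top:
  assumes "even N"
  shows "fact N * of_int (bern_den N * bern_lcm N) * todd_factor 1 $ N = of_int (bern_num N * bern_lcm N)"
proof -
  have "fact N * of_int (bern_den N * bern_lcm N) * todd_factor 1 $ N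
      = of_int (bern_lcm N) * of_rat (of_int (bern_den N) * bernoulli N)"
    using assms by (simp add: nth_todd_factor_1 of_rat_mult)
  then show ?thesis by (simp add: bern_den_mult_bernoulli)
qed

text \<open>This coefficient belongs to the ray shared by the two pieces of the subdivision. As
  \<open>N - 1\<close> is odd, it can be nonzero only for \<open>N = 2\<close>, where
  \<open>fact N\<close> clears the 1/2.\<close>

lemma todd_coeff_pred_integral:
  assumes "even N" "N > 0"
  shows "fact N * of_int (bern_den N * bern_lcm N) * todd_factor 1 $ (N - 1) \<in> \<int>"
proof (cases "N = 2")
  case True
  then show ?thesis by (simp add: nth_todd_factor_1 bernoulli_1[simplified] of_rat_divide of_rat_minus)
next
  case False
  with assms have "odd (N - 1)" "N - 1 \<noteq> 1" by auto
  then show ?thesis by (simp add: nth_todd_factor_1 bernoulli_odd)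
qed

section \<open>Integer polynomials in two variables\<close>

text \<open>Integer polynomials are handled through the functions they define, so that substituting
  linear forms is composition.\<close>

inductive_set int_poly_fun :: "(complex \<Rightarrow> complex \<Rightarrow> complex) set" where
  const: "(\<lambda>_ _. of_int c) \<in> int_poly_fun"
| fst: "(\<lambda>u _. u) \<in> int_poly_fun"
| snd: "(\<lambda>_ w. w) \<in> int_poly_fun"
| add: "f \<in> int_poly_fun \<Longrightarrow> g \<in> int_poly_fun \<Longrightarrow> (\<lambda>u w. f u w + g u w) \<in> int_poly_fun"
| mult: "f \<in> int_poly_fun \<Longrightarrow> g \<in> int_poly_fun \<Longrightarrow> (\<lambda>u w. f u w * g u w) \<in> int_poly_fun"

lemma int_poly_fun_subst:
  assumes "f \<in> int_poly_fun" "g \<in> int_poly_fun" "h \<in> int_poly_fun"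
  shows "(\<lambda>u w. f (g u w) (h u w)) \<in> int_poly_fun"
  using assms(1) by induction (auto intro: int_poly_fun.intros assms(2,3))

lemma int_poly_fun_numeric [intro]:
  "(\<lambda>_ _. 0) \<in> int_poly_fun" "(\<lambda>_ _. 1) \<in> int_poly_fun"
  using int_poly_fun.const[of 0] int_poly_fun.const[of 1] by simp_all

lemma int_poly_fun_uminus:
  assumes "f \<in> int_poly_fun"
  shows "(\<lambda>u w. - f u w) \<in> int_poly_fun"
  using int_poly_fun.mult[OF int_poly_fun.const[of "-1"] assms] by simp

lemma int_poly_fun_diff:
  assumes "f \<in> int_poly_fun" "g \<in> int_poly_fun"
  shows "(\<lambda>u w. f u w - g u w) \<in> int_poly_fun"
  using int_poly_fun.add[OF assms(1) int_poly_fun_uminus[OF assms(2)]] by simp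

lemma int_poly_fun_power:
  assumes "f \<in> int_poly_fun"
  shows "(\<lambda>u w. f u w ^ k) \<in> int_poly_fun"
  by (induction k) (auto intro: int_poly_fun.mult assms)

lemma int_poly_fun_sum:
  assumes "\<And>i. i \<in> A \<Longrightarrow> f i \<in> int_poly_fun"
  shows "(\<lambda>u w. \<Sum>i\<in>A. f i u w) \<in> int_poly_fun"
  using assms by (induction A rule: infinite_finite_induct) (auto intro: int_poly_fun.add)

lemma int_poly_fun_Ints: "c \<in> \<int> \<Longrightarrow> (\<lambda>_ _. c) \<in> int_poly_fun"
  by (auto elim!: Ints_cases intro: int_poly_fun.const)

lemmas int_poly_fun_intros = int_poly_fun.intros int_poly_fun_numeric int_poly_fun_uminus
  int_poly_fun_diff int_poly_fun_power int_poly_fun_sum int_poly_fun_Ints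

text \<open>Over the integers a^k - b^k is divisible by a - b. This lets a linear form inside a
  power be changed by a multiple of another one, with an integral error.\<close>

lemma int_poly_fun_power_diff:
  assumes "f \<in> int_poly_fun" "g \<in> int_poly_fun"
  obtains h where "h \<in> int_poly_fun"
    "\<And>u w. (f u w + g u w) ^ k = f u w ^ k + g u w * h u w"
proof -
  define h where "h = (\<lambda>u w. \<Sum>i<k. f u w ^ (k - Suc i) * (f u w + g u w) ^ i)"
  have "h \<in> int_poly_fun" unfolding h_def by (intro int_poly_fun_intros assms)
  moreover have "(f u w + g u w) ^ k = f u w ^ k + g u w * h u w" for u w
    using power_diff_sumr2[of "f u w + g u w" k "f u w"] by (simp add: h_def algebra_simps)
  ultimately show thesis using that by blast
qed

section \<open>Polynomials in x and y and their values\<close>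

lemma int_polys_xy_const: "of_int c \<in> int_polys_xy"
  by (auto simp: int_polys_xy_def of_int_poly coeff_pCons split: nat.splits)

lemma int_polys_xy_add: "P \<in> int_polys_xy \<Longrightarrow> Q \<in> int_polys_xy \<Longrightarrow> P + Q \<in> int_polys_xy"
  by (auto simp: int_polys_xy_def)

lemma int_polys_xy_mult: "P \<in> int_polys_xy \<Longrightarrow> Q \<in> int_polys_xy \<Longrightarrow> P * Q \<in> int_polys_xy"
  by (auto simp: int_polys_xy_def coeff_mult coeff_sum intro!: Ints_sum Ints_mult)

lemma int_polys_xy_vars: "var_x \<in> int_polys_xy" "var_y \<in> int_polys_xy"
  by (auto simp: int_polys_xy_def var_x_def var_y_def coeff_pCons split: nat.splits)

definition eval_xy :: "complex poly poly \<Rightarrow> complex \<Rightarrow> complex \<Rightarrow> complex" where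
  "eval_xy P x y = poly (poly P [:y:]) x"

lemma eval_xy_simps:
  "eval_xy (P + Q) x y = eval_xy P x y + eval_xy Q x y"
  "eval_xy (P - Q) x y = eval_xy P x y - eval_xy Q x y"
  "eval_xy (P * Q) x y = eval_xy P x y * eval_xy Q x y"
  "eval_xy (P ^ k) x y = eval_xy P x y ^ k"
  "eval_xy (of_int c) x y = of_int c"
  "eval_xy var_x x y = x"
  "eval_xy var_y x y = y"
  by (simp_all add: eval_xy_def var_x_def var_y_def of_int_poly)

lemma eval_xy_homogeneous_part:
  "eval_xy (homogeneous_part N F) x y = (\<Sum>i\<le>N. F $ (N - i) $ i * x ^ i * y ^ (N - i))"
  by (simp add: eval_xy_def homogeneous_part_def poly_sum poly_monom mult_ac)

text \<open>The witnesses are i t y with real t > 0, whose product with \<open>cnj y\<close> is i t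
  |y|^2.\<close>

lemma infinite_Im_mult_cnj_nonzero:
  assumes "y \<noteq> 0"
  shows "infinite {x. Im (x * cnj y) \<noteq> 0}"
proof -
  have "(\<lambda>t. \<i> * of_real t * y) ` {0<..} \<subseteq> {x. Im (x * cnj y) \<noteq> 0}"
  proof safe
    fix t :: real assume "t > 0" "Im (\<i> * of_real t * y * cnj y) = 0"
    moreover have "\<i> * of_real t * y * cnj y = \<i> * of_real (t * (cmod y)\<^sup>2)"
      by (simp only: mult.assoc of_real_mult complex_norm_square)
    ultimately show False using assms by simp
  qed
  moreover have "inj_on (\<lambda>t. \<i> * of_real t * y) {0<..}" using assms by (auto simp: inj_on_def)
  ultimately show ?thesis
    by (metis finite_imageD finite_subset infinite_Ioi)
qed

text \<open>For fixed nonzero y the difference has infinitely many roots x, hence vanishes as a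
  polynomial in x. As a polynomial in the outer variable over the domain C[x] it then has infinitely
  many constant roots.\<close>

lemma poly_xy_eqI:
  assumes "\<And>x y. Im (x * cnj y) \<noteq> 0 \<Longrightarrow> eval_xy P x y = eval_xy Q x y"
  shows "P = Q"
proof -
  have *: "poly (P - Q) [:y:] = 0" if "y \<noteq> 0" for y
  proof (rule ccontr)
    assume "poly (P - Q) [:y:] \<noteq> 0"
    then have "finite {x. poly (poly (P - Q) [:y:]) x = 0}" by (rule poly_roots_finite)
    moreover have "{x. Im (x * cnj y) \<noteq> 0} \<subseteq> {x. poly (poly (P - Q) [:y:]) x = 0}"
      using assms by (auto simp: eval_xy_def)
    ultimately show False using infinite_Im_mult_cnj_nonzero[OF that] finite_subset by blast
  qed
  have "P - Q = 0"
  proof (rule ccontr)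
    assume "P - Q \<noteq> 0"
    then have "finite {c. poly (P - Q) c = 0}" by (rule poly_roots_finite)
    moreover have "(\<lambda>y. [:y:]) ` (- {0}) \<subseteq> {c. poly (P - Q) c = 0}" using * by auto
    ultimately have "finite ((\<lambda>y. [:y:]) ` (- {0 :: complex}))" by (rule rev_finite_subset)
    then have "finite (- {0 :: complex})" by (rule finite_imageD) (auto simp: inj_on_def)
    then show False by (simp add: finite_compl infinite_UNIV_char_0)
  qed
  then show ?thesis by simp
qed

lemma int_poly_fun_imp_int_polys_xy:
  assumes "f \<in> int_poly_fun"
  shows "\<exists>P\<in>int_polys_xy. \<forall>x y. eval_xy P x y = f x y"
  using assms
proof induction
  case (const c)
  show ?case by (rule bexI[OF _ int_polys_xy_const[of c]]) (simp add: eval_xy_simps)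
next
  case fst
  show ?case by (rule bexI[OF _ int_polys_xy_vars(1)]) (simp add: eval_xy_simps)
next
  case snd
  show ?case by (rule bexI[OF _ int_polys_xy_vars(2)]) (simp add: eval_xy_simps)
next
  case (add f g)
  then show ?case by (metis eval_xy_simps(1) int_polys_xy_add)
next
  case (mult f g)
  then show ?case by (metis eval_xy_simps(3) int_polys_xy_mult)
qed

section \<open>Subdivision of the cone\<close>

text \<open>The points (r, s) of the square [0, q)^2 with s congruent to p r modulo q, weighted by
  e^(-(r x + s y) t), where t is the series variable.\<close>

definition box_sum :: "int \<Rightarrow> int \<Rightarrow> complex \<Rightarrow> complex \<Rightarrow> complex fps" where
  "box_sum p q x y = (\<Sum>r\<in>{0..<q}. fps_exp (- (of_int r * x + of_int (p * r mod q) * y)))"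

text \<open>The condition \<open>p * r mod q < p\<close> says that a multiple k q lies above p (r -
  1) and not above p r. Then r is the ceiling of k q / p, written as a negated floor, and the
  residue is that of -q k modulo p; hence the parameter \<open>-q\<close> of the smaller
  cone.\<close>

lemma wrap_sum_reindex:
  fixes p q :: int and g :: "int \<Rightarrow> int \<Rightarrow> 'a :: comm_monoid_add"
  assumes "0 < p" "p < q"
  shows "(\<Sum>r | r \<in> {1..q} \<and> p * r mod q < p. g r (p * r mod q)) =
         (\<Sum>k\<in>{1..p}. g (- ((- q * k) div p)) ((- q * k) mod p))"
proof (rule sum.reindex_bij_witness[of _ "\<lambda>k. - ((- q * k) div p)" "\<lambda>r. p * r div q"])
  fix r assume "r \<in> {r. r \<in> {1..q} \<and> p * r mod q < p}"
  then have r: "1 \<le> r" "r \<le> q" "p * r mod q < p" by auto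
  define k where "k = p * r div q"
  define m where "m = p * r mod q"
  have e: "p * r = q * k + m" by (simp add: k_def m_def)
  have m: "0 \<le> m" "m < p" using assms r by (auto simp: m_def)
  have "- q * k = m + (- r) * p" using e by (simp add: algebra_simps)
  then have dm: "(- q * k) div p = - r" "(- q * k) mod p = m"
    using m div_mult_self1[of p m "- r"] mod_mult_self1[of m "- r" p] by simp_all
  have "p \<le> p * r" using assms r by simp
  then have "q * k > 0" using e m by linarith
  then have k1: "k \<ge> 1" using assms by (simp add: zero_less_mult_iff)
  have "q * k \<le> p * r" using e m by linarith
  also have "\<dots> \<le> q * p" using assms r by (simp add: mult.commute mult_right_mono)
  finally have k2: "k \<le> p" using assms by simp
  show "- ((- q * (p * r div q)) div p) = r" using dm by (simp add: k_def)
  show "p * r div q \<in> {1..p}" using k1 k2 by (simp add: k_def)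
  show "g (- ((- q * (p * r div q)) div p)) ((- q * (p * r div q)) mod p) = g r (p * r mod q)"
    using dm by (simp add: k_def m_def)
next
  fix k assume "k \<in> {1..p}"
  then have k: "1 \<le> k" "k \<le> p" by auto
  define r where "r = - ((- q * k) div p)"
  define m where "m = (- q * k) mod p"
  have m: "0 \<le> m" "m < p" using assms by (auto simp: m_def)
  have "- q * k = p * ((- q * k) div p) + (- q * k) mod p" by simp
  then have "- q * k = p * (- r) + m" unfolding r_def m_def by simp
  then have e: "p * r = k * q + m" by (simp add: algebra_simps)
  have dm: "p * r div q = k" "p * r mod q = m" using e m assms by simp_all
  have "k * q > 0" using assms k by simp
  then have "p * r > 0" using e m by linarith
  then have r1: "r \<ge> 1" using assms by (simp add: zero_less_mult_iff)
  have "k * q \<le> p * q" using assms k by simp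
  then have "p * r < p * (q + 1)" using e m by (simp add: algebra_simps)
  then have r2: "r \<le> q" using assms by simp
  show "p * (- ((- q * k) div p)) div q = k" using dm by (simp add: r_def)
  show "- ((- q * k) div p) \<in> {r. r \<in> {1..q} \<and> p * r mod q < p}"
    using r1 r2 dm m unfolding r_def[symmetric] by simp
qed

lemma mod_step:
  fixes p q r :: int
  assumes "0 < p" "p < q"
  shows "p * (r - 1) mod q + p = p * r mod q + (if p * r mod q < p then q else 0)"
proof -
  define a where "a = p * (r - 1) mod q"
  have a: "0 \<le> a" "a < q" using assms by (auto simp: a_def)
  have "p * r mod q = (a + p) mod q"
    unfolding a_def mod_add_left_eq by (simp add: algebra_simps)
  also have "\<dots> = (if a + p < q then a + p else a + p - q)"
    using a assms mod_pos_pos_trivial[of "a + p - q" q] by auto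
  finally show ?thesis using a assms by (auto simp: a_def[symmetric])
qed

text \<open>Subdividing the cone along the ray through \<open>(1, p)\<close>: the lattice points of the
  parallelogram are followed along \<open>r \<mapsto> r + 1\<close>, and each wrap-around modulo \<open>q\<close> contributes one
  point of the smaller parallelogram.\<close>

lemma box_sum_subdivide:
  fixes p q :: int
  assumes "0 < p" "p < q"
  shows "box_sum p q x y * (1 - fps_exp (- (x + of_int p * y))) =
         box_sum (- q) p (of_int q * x / of_int p) ((x + of_int p * y) / of_int p)
           * (1 - fps_exp (- (of_int q * y)))
         + (1 - fps_exp (- (of_int q * x))) * fps_exp (- (of_int q * y))"
proof -
  define g :: "int \<Rightarrow> int \<Rightarrow> complex fps"
    where "g = (\<lambda>r s. fps_exp (- (of_int r * x + of_int s * y)))"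
  have g_add: "g r s * g r' s' = g (r + r') (s + s')" for r s r' s'
    by (simp add: g_def algebra_simps flip: fps_exp_add_mult)
  have g00: "g 0 0 = 1" by (simp add: g_def)
  have P: "box_sum p q x y = (\<Sum>r\<in>{0..<q}. g r (p * r mod q))" by (simp add: box_sum_def g_def)
  let ?W = "\<Sum>r | r \<in> {1..q} \<and> p * r mod q < p. g r (p * r mod q)"
  \<comment> \<open>Both ends have residue 0: r = 0 contributes 1 and r = q contributes
    \<open>g q 0\<close>.\<close>
  have eq1: "insert 0 {1..q} = insert q {0..<q}" using assms by auto
  have "(\<Sum>r\<in>insert 0 {1..q}. g r (p * r mod q)) = (\<Sum>r\<in>insert q {0..<q}. g r (p * r mod q))"
    by (simp only: eq1)
  then have sum1: "(\<Sum>r\<in>{1..q}. g r (p * r mod q)) = box_sum p q x y + g q 0 - 1"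
    by (simp add: P g00 algebra_simps)
  have "box_sum p q x y * g 1 p = (\<Sum>r\<in>{0..<q}. g (r + 1) (p * r mod q + p))"
    by (simp add: P sum_distrib_right g_add)
  also have "\<dots> = (\<Sum>r\<in>{1..q}. g r (p * (r - 1) mod q + p))"
    by (rule sum.reindex_bij_witness[of _ "\<lambda>r. r - 1" "\<lambda>r. r + 1"]) auto
  \<comment> \<open>At a wrap-around the shifted point lies q above the reduced one, which costs a
    factor \<open>g 0 q\<close>.\<close>
  also have "\<dots> = (\<Sum>r\<in>{1..q}. g r (p * r mod q)
                      - (if p * r mod q < p then g r (p * r mod q) * (1 - g 0 q) else 0))"
    by (intro sum.cong refl) (simp only: mod_step[OF assms], simp add: g_add right_diff_distrib)
  also have "\<dots> = box_sum p q x y + g q 0 - 1 - ?W * (1 - g 0 q)"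
    by (simp add: sum_subtractf sum1 sum.inter_filter[symmetric] sum_distrib_right)
  finally have main: "box_sum p q x y * (1 - g 1 p) = 1 - g q 0 + ?W * (1 - g 0 q)"
    by (simp add: algebra_simps)
  \<comment> \<open>These arguments make the exponents agree: if p r = k q + m, then k
    \<open>?X\<close> + m \<open>?Y\<close> equals r x + m y.\<close>
  let ?X = "of_int q * x / of_int p" and ?Y = "(x + of_int p * y) / of_int p"
  let ?h = "\<lambda>k. g (- ((- q * k) div p)) ((- q * k) mod p)"
  have h: "fps_exp (- (of_int k * ?X + of_int ((- q * k) mod p) * ?Y)) = ?h k" for k
  proof -
    define r where "r = - ((- q * k) div p)"
    define m where "m = (- q * k) mod p"
    have "- q * k = p * ((- q * k) div p) + (- q * k) mod p" by simp
    then have "- q * k = p * (- r) + m" unfolding r_def m_def by simp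
    then have "p * r = k * q + m" by (simp add: algebra_simps)
    then have "of_int (p * r) = (of_int (k * q + m) :: complex)" by (simp only:)
    then have e: "of_int p * of_int r = (of_int k * of_int q + of_int m :: complex)" by simp
    have "of_int k * ?X + of_int m * ?Y = (of_int k * of_int q + of_int m) * x / of_int p + of_int m * y"
      using assms by (simp add: field_simps)
    also have "\<dots> = of_int r * x + of_int m * y"
      unfolding e[symmetric] using assms by simp
    finally show ?thesis unfolding g_def r_def m_def by simp
  qed
  have eq2: "insert 0 {1..p} = insert p {0..<p}" using assms by auto
  have "(\<Sum>k\<in>insert 0 {1..p}. ?h k) = (\<Sum>k\<in>insert p {0..<p}. ?h k)" by (simp only: eq2)
  moreover have "(- q * p) div p = - q" using assms by (intro nonzero_mult_div_cancel_right) simp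
  then have "?h p = g q 0" by simp
  moreover have "?h 0 = 1" by (simp add: g00)
  ultimately have "(\<Sum>k\<in>{1..p}. ?h k) + 1 = (\<Sum>k\<in>{0..<p}. ?h k) + g q 0"
    by (simp add: add.commute)
  moreover have "box_sum (- q) p ?X ?Y = (\<Sum>k\<in>{0..<p}. ?h k)" by (simp only: box_sum_def h)
  ultimately have W: "?W = box_sum (- q) p ?X ?Y + g q 0 - 1"
    unfolding wrap_sum_reindex[OF assms] by (simp add: algebra_simps)
  have "g 1 p = fps_exp (- (x + of_int p * y))" "g q 0 = fps_exp (- (of_int q * x))"
    "g 0 q = fps_exp (- (of_int q * y))" by (simp_all add: g_def)
  with main[unfolded W] show ?thesis by (simp add: algebra_simps)
qed

section \<open>The Todd series on a line\<close>

definition root_char :: "int \<Rightarrow> int \<Rightarrow> complex" where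
  "root_char q m = exp (2 * of_real pi * \<i> * of_rat (of_int m / of_int q))"

lemma root_char_add: "root_char q (m + n) = root_char q m * root_char q n"
  by (simp add: root_char_def add_divide_distrib of_rat_add ring_distribs exp_add)

lemma root_char_power: "root_char q m ^ k = root_char q (int k * m)"
  by (induction k) (auto simp: root_char_add ring_distribs, simp add: root_char_def)

lemma root_char_eq_1_iff:
  assumes "q > 0"
  shows "root_char q m = 1 \<longleftrightarrow> q dvd m"
proof -
  have eq: "root_char q m = cis (2 * pi * of_int m / of_int q)"
    by (simp add: root_char_def cis_conv_exp of_rat_divide mult_ac)
  show ?thesis
  proof
    assume "root_char q m = 1"
    then have "cos (2 * pi * of_int m / of_int q) = 1"
      unfolding eq by (metis cis.sel(1) one_complex.sel(1))
    then obtain n :: int where "2 * pi * of_int m / of_int q = of_int n * 2 * pi"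
      by (auto simp: cos_one_2pi_int)
    then have "(of_int m :: real) = of_int (q * n)" using assms by (simp add: field_simps)
    then show "q dvd m" by (simp only: of_int_eq_iff) simp
  next
    assume "q dvd m"
    then obtain n where "m = q * n" by auto
    then have "2 * pi * of_int m / of_int q = 2 * pi * of_int n" using assms by simp
    then show "root_char q m = 1" unfolding eq by (simp add: cis_multiple_2pi)
  qed
qed

lemma sum_root_char:
  assumes "q > 0"
  shows "(\<Sum>k\<in>{0..<q}. root_char q (k * m)) = (if q dvd m then of_int q else 0)"
proof -
  have "(\<Sum>k\<in>{0..<q}. root_char q (k * m)) = (\<Sum>k<nat q. root_char q m ^ k)"
    by (rule sum.reindex_bij_witness[of _ int nat]) (auto simp: root_char_power)
  also have "\<dots> = (if q dvd m then of_int q else 0)"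
  proof (cases "q dvd m")
    case True
    then have "root_char q m = 1" using assms root_char_eq_1_iff by simp
    then show ?thesis using True assms by simp
  next
    case False
    have "root_char q m ^ nat q = 1"
      using assms root_char_eq_1_iff[of q "q * m"] by (simp add: root_char_power)
    then show ?thesis
      using False assms root_char_eq_1_iff[of q m] by (simp add: sum_gp_strict)
  qed
  finally show ?thesis .
qed

text \<open>Multiples of (p, q) reduce the second coordinate modulo q, and multiples of (1, 0) then
  clear the first.\<close>

lemma cone_group_bij:
  assumes "q > 0"
  shows "bij_betw (\<lambda>k. cone_lattice_rel (1, 0) (p, q) `` {(0, k)}) {0..<q} (cone_group (1, 0) (p, q))"
    (is "bij_betw ?c _ _")
proof (rule bij_betwI')
  fix k l assume kl: "k \<in> {0..<q}" "l \<in> {0..<q}"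
  show "(?c k = ?c l) = (k = l)"
  proof
    assume "?c k = ?c l"
    then have "((0, k), (0, l)) \<in> cone_lattice_rel (1, 0) (p, q)"
      using eq_equiv_class[OF _ equiv_cone_lattice_rel] by blast
    then obtain n where "k - l = n * q" by (auto simp: cone_lattice_rel_def)
    then have "k mod q = l mod q" by (simp add: mod_eq_dvd_iff)
    then show "k = l" using kl by simp
  qed simp
next
  fix k show "?c k \<in> cone_group (1, 0) (p, q)"
    unfolding cone_group_def by (rule quotientI) simp
next
  fix \<gamma> assume "\<gamma> \<in> cone_group (1, 0) (p, q)"
  then obtain a b where g: "\<gamma> = cone_lattice_rel (1, 0) (p, q) `` {(a, b)}"
    unfolding cone_group_def by (auto elim!: quotientE)
  have "((a, b), (0, b mod q)) \<in> cone_lattice_rel (1, 0) (p, q)"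
    unfolding cone_lattice_rel_def mem_Collect_eq case_prod_conv
    by (intro exI[where x = "a - b div q * p"] exI[where x = "b div q"])
      (simp add: minus_mod_eq_div_mult)
  then have "\<gamma> = ?c (b mod q)"
    unfolding g by (rule equiv_class_eq[OF equiv_cone_lattice_rel])
  moreover have "b mod q \<in> {0..<q}" using assms by simp
  ultimately show "\<exists>k\<in>{0..<q}. \<gamma> = ?c k" by blast
qed

lemma Td_eq_sum:
  assumes "q > 0"
  shows "Td p q = (\<Sum>k\<in>{0..<q}. series_in_x (todd_factor (root_char q (- p * k)))
                                * series_in_y (todd_factor (root_char q k)))"
  unfolding Td_def cone_todd_def
proof (subst sum.reindex_bij_betw[OF cone_group_bij[OF assms], symmetric], intro sum.cong refl)
  fix k
  let ?g = "cone_lattice_rel (1, 0) (p, q) `` {(0, k)}"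
  have "?g \<in> cone_group (1, 0) (p, q)"
    unfolding cone_group_def by (rule quotientI) simp
  moreover have "(0, k) \<in> ?g"
    using equiv_class_self[OF equiv_cone_lattice_rel] by simp
  moreover have "q \<noteq> 0" using assms by simp
  ultimately show "series_in_x (todd_factor (cone_chi1 (1, 0) (p, q) ?g))
           * series_in_y (todd_factor (cone_chi2 (1, 0) (p, q) ?g)) =
         series_in_x (todd_factor (root_char q (- p * k))) * series_in_y (todd_factor (root_char q k))"
    by (simp add: cone_chi_class[of q _ p "(0, k)"] cone_coords_pq root_char_def)
qed

section \<open>Todd factors and the Todd series restricted to a line\<close>

definition todd_at :: "complex \<Rightarrow> complex \<Rightarrow> complex fps" where
  "todd_at c x = todd_factor c oo (fps_const x * fps_X)"

lemma nth_todd_at: "todd_at c x $ n = x ^ n * todd_factor c $ n"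
  by (simp add: todd_at_def fps_compose_linear)

lemma todd_at_mult: "todd_at c x * (1 - fps_const c * fps_exp (- x)) = fps_const x * fps_X"
proof -
  have "(todd_factor c * (1 - fps_const c * fps_exp (-1))) oo (fps_const x * fps_X)
          = fps_X oo (fps_const x * fps_X)"
    by (simp only: todd_factor_mult)
  then show ?thesis
    by (simp add: todd_at_def fps_compose_mult_distrib fps_compose_sub_distrib)
qed

text \<open>Extending the fraction by a geometric sum replaces the denominator 1 - c e^(-x t) by 1 -
  e^(-q x t), which is the same for every character.\<close>

lemma todd_at_mult_root:
  assumes "c ^ q = 1"
  shows "todd_at c x * (1 - fps_exp (- (of_nat q * x))) =
         fps_const x * fps_X * (\<Sum>r<q. fps_const (c ^ r) * fps_exp (- (of_nat r * x)))"
proof -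
  let ?a = "fps_const c * fps_exp (- x)"
  have pow: "?a ^ r = fps_const (c ^ r) * fps_exp (- (of_nat r * x))" for r
    by (simp add: power_mult_distrib fps_const_power fps_exp_power_mult)
  have "1 - fps_exp (- (of_nat q * x)) = 1 - ?a ^ q" using assms by (simp add: pow)
  also have "\<dots> = (1 - ?a) * (\<Sum>r<q. ?a ^ r)" by (rule one_diff_power_eq)
  finally have "todd_at c x * (1 - fps_exp (- (of_nat q * x))) =
      (todd_at c x * (1 - ?a)) * (\<Sum>r<q. ?a ^ r)"
    by (simp only: mult.assoc)
  then show ?thesis by (simp only: todd_at_mult pow)
qed

lemma todd_at_mult_root_char:
  assumes "q > 0"
  shows "todd_at (root_char q m) x * (1 - fps_exp (- (of_int q * x))) =
         fps_const x * fps_X * (\<Sum>r\<in>{0..<q}. fps_const (root_char q (r * m)) * fps_exp (- (of_int r * x)))"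
proof -
  have "root_char q m ^ nat q = 1"
    using assms root_char_eq_1_iff[of q "q * m"] by (simp add: root_char_power)
  from todd_at_mult_root[OF this, of x]
  have "todd_at (root_char q m) x * (1 - fps_exp (- (of_int q * x))) =
    fps_const x * fps_X * (\<Sum>r<nat q. fps_const (root_char q m ^ r) * fps_exp (- (of_nat r * x)))"
    using assms by simp
  also have "(\<Sum>r<nat q. fps_const (root_char q m ^ r) * fps_exp (- (of_nat r * x))) =
    (\<Sum>r\<in>{0..<q}. fps_const (root_char q (r * m)) * fps_exp (- (of_int r * x)))"
    by (rule sum.reindex_bij_witness[of _ nat int]) (auto simp: root_char_power)
  finally show ?thesis .
qed

definition Td_at :: "int \<Rightarrow> int \<Rightarrow> complex \<Rightarrow> complex \<Rightarrow> complex fps" where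
  "Td_at p q x y = (\<Sum>k\<in>{0..<q}. todd_at (root_char q (- p * k)) x * todd_at (root_char q k) y)"

lemma nth_series_mult: "(series_in_x f * series_in_y g) $ j $ i = f $ i * g $ j"
  by (simp add: series_in_x_def series_in_y_def mult.commute)

lemma nth_nth_sum: "(\<Sum>k\<in>A. F k) $ j $ i = (\<Sum>k\<in>A. F k $ j $ i)"
  by (induction A rule: infinite_finite_induct) auto

text \<open>On the line the homogeneous degree becomes the exponent of the series variable.\<close>

lemma nth_Td_at:
  assumes "q > 0"
  shows "Td_at p q x y $ N = (\<Sum>i\<le>N. Td p q $ (N - i) $ i * x ^ i * y ^ (N - i))"
proof -
  have "(\<Sum>i\<le>N. Td p q $ (N - i) $ i * x ^ i * y ^ (N - i)) =
    (\<Sum>i\<le>N. \<Sum>k\<in>{0..<q}. todd_at (root_char q (- p * k)) x $ i * todd_at (root_char q k) y $ (N - i))"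
    by (intro sum.cong refl)
      (simp only: Td_eq_sum[OF assms] nth_nth_sum nth_series_mult nth_todd_at sum_distrib_right,
       simp only: mult_ac)
  also have "\<dots> = (\<Sum>k\<in>{0..<q}. (todd_at (root_char q (- p * k)) x * todd_at (root_char q k) y) $ N)"
    by (subst sum.swap) (simp add: fps_mult_nth atLeast0AtMost)
  finally show ?thesis by (simp add: Td_at_def fps_sum_nth)
qed

text \<open>Once the summands share their denominators, the sum over the characters can be taken
  innermost; by orthogonality only the points with s congruent to p r modulo q survive, each with
  weight q.\<close>

lemma Td_at_mult:
  assumes "q > 0"
  shows "Td_at p q x y * (1 - fps_exp (- (of_int q * x))) * (1 - fps_exp (- (of_int q * y))) =
         fps_const (of_int q * x * y) * fps_X ^ 2 * box_sum p q x y"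
proof -
  let ?E = "\<lambda>r s. fps_exp (- (of_int r * x + of_int s * y))"
  have "Td_at p q x y * (1 - fps_exp (- (of_int q * x))) * (1 - fps_exp (- (of_int q * y))) =
    (\<Sum>k\<in>{0..<q}. (todd_at (root_char q (- p * k)) x * (1 - fps_exp (- (of_int q * x)))) *
                  (todd_at (root_char q k) y * (1 - fps_exp (- (of_int q * y)))))"
    unfolding Td_at_def sum_distrib_right by (simp only: mult_ac)
  also have "\<dots> = (\<Sum>k\<in>{0..<q}. fps_const (x * y) * fps_X ^ 2 *
      (\<Sum>r\<in>{0..<q}. \<Sum>s\<in>{0..<q}. fps_const (root_char q (k * (s - p * r))) * ?E r s))"
  proof (intro sum.cong refl)
    fix k
    have "(\<Sum>r\<in>{0..<q}. fps_const (root_char q (r * (- p * k))) * fps_exp (- (of_int r * x))) *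
      (\<Sum>s\<in>{0..<q}. fps_const (root_char q (s * k)) * fps_exp (- (of_int s * y))) =
      (\<Sum>r\<in>{0..<q}. \<Sum>s\<in>{0..<q}. fps_const (root_char q (k * (s - p * r))) * ?E r s)"
      unfolding sum_product
    proof (intro sum.cong refl)
      fix r s
      have "root_char q (k * (s - p * r)) = root_char q (r * (- p * k)) * root_char q (s * k)"
        by (simp add: algebra_simps flip: root_char_add)
      moreover have "?E r s = fps_exp (- (of_int r * x)) * fps_exp (- (of_int s * y))"
        by (simp add: algebra_simps flip: fps_exp_add_mult)
      ultimately show "fps_const (root_char q (r * (- p * k))) * fps_exp (- (of_int r * x)) *
         (fps_const (root_char q (s * k)) * fps_exp (- (of_int s * y))) =
         fps_const (root_char q (k * (s - p * r))) * ?E r s"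
        by (simp add: mult_ac flip: fps_const_mult)
    qed
    then show "(todd_at (root_char q (- p * k)) x * (1 - fps_exp (- (of_int q * x)))) *
                  (todd_at (root_char q k) y * (1 - fps_exp (- (of_int q * y)))) =
       fps_const (x * y) * fps_X ^ 2 *
      (\<Sum>r\<in>{0..<q}. \<Sum>s\<in>{0..<q}. fps_const (root_char q (k * (s - p * r))) * ?E r s)"
      unfolding todd_at_mult_root_char[OF assms]
      by (simp add: power2_eq_square mult_ac flip: fps_const_mult)
  qed
  also have "\<dots> = fps_const (x * y) * fps_X ^ 2 * (\<Sum>r\<in>{0..<q}. \<Sum>s\<in>{0..<q}. \<Sum>k\<in>{0..<q}.
      fps_const (root_char q (k * (s - p * r))) * ?E r s)"
    unfolding sum_distrib_left[symmetric]
    by (subst sum.swap, subst (2) sum.swap) simp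
  also have "(\<Sum>r\<in>{0..<q}. \<Sum>s\<in>{0..<q}. \<Sum>k\<in>{0..<q}. fps_const (root_char q (k * (s - p * r))) * ?E r s)
     = (\<Sum>r\<in>{0..<q}. fps_const (of_int q) * ?E r (p * r mod q))"
  proof (intro sum.cong refl)
    fix r
    have "(\<Sum>k\<in>{0..<q}. fps_const (root_char q (k * (s - p * r))) * ?E r s) =
          (if s = p * r mod q then fps_const (of_int q) * ?E r s else 0)" if "s \<in> {0..<q}" for s
    proof -
      have "(\<Sum>k\<in>{0..<q}. fps_const (root_char q (k * (s - p * r)))) =
         fps_const (\<Sum>k\<in>{0..<q}. root_char q (k * (s - p * r)))"
        by (rule fps_ext) (simp add: fps_sum_nth)
      moreover have "q dvd s - p * r \<longleftrightarrow> s = p * r mod q"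
        using that by (auto simp flip: mod_eq_dvd_iff)
      ultimately show ?thesis by (simp add: sum_root_char[OF assms] flip: sum_distrib_right)
    qed
    then have "(\<Sum>s\<in>{0..<q}. \<Sum>k\<in>{0..<q}. fps_const (root_char q (k * (s - p * r))) * ?E r s) =
      (\<Sum>s\<in>{0..<q}. if s = p * r mod q then fps_const (of_int q) * ?E r s else 0)"
      by (intro sum.cong refl) blast
    also have "\<dots> = fps_const (of_int q) * ?E r (p * r mod q)"
      using assms by simp
    finally show "(\<Sum>s\<in>{0..<q}. \<Sum>k\<in>{0..<q}. fps_const (root_char q (k * (s - p * r))) * ?E r s) =
      fps_const (of_int q) * ?E r (p * r mod q)" .
  qed
  finally show ?thesis
    by (simp add: box_sum_def mult_ac flip: sum_distrib_left fps_const_mult)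
qed

section \<open>Induction on the index of the cone\<close>

text \<open>Here \<open>k\<close>, \<open>a\<close>, \<open>b\<close> stand for q, x, y, and
  \<open>Dx\<close>, \<open>Dy\<close>, \<open>Du\<close> for the denominators of the two old rays
  and the new one. Splitting \<open>1 - Dy\<close> yields the last two summands.\<close>

lemma subdivision_algebra:
  fixes F F' S S' :: "'a :: idom"
  assumes F: "F * Dx * Dy = k * a * b * X ^ 2 * S"
    and F': "F' * Dx * Du = e * X ^ 2 * S'"
    and S: "S * Du = S' * Dy + Dx * (1 - Dy)"
    and tu: "tu * Du = u * X" and tw: "tw * Dy = k * b * X"
    and he: "h * e = u * k * a * b"
    and nz: "Dx \<noteq> 0" "Dy \<noteq> 0" "Du \<noteq> 0"
  shows "u * F = h * F' + a * tu * tw - k * a * b * X * tu"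
proof -
  have "(u * F) * (Dx * Dy * Du) = u * k * a * b * X ^ 2 * (S * Du)"
    using F by (simp add: mult_ac)
  also have "\<dots> = (h * e) * X ^ 2 * S' * Dy + u * k * a * b * X ^ 2 * Dx * (1 - Dy)"
    unfolding S he by (simp add: algebra_simps)
  also have "(h * e) * X ^ 2 * S' * Dy = (h * F') * (Dx * Dy * Du)"
    using F' by (simp add: mult_ac)
  also have "u * k * a * b * X ^ 2 * Dx * (1 - Dy) =
      a * (u * X) * (k * b * X) * Dx - k * a * b * X * (u * X) * Dx * Dy"
    by (simp add: algebra_simps power2_eq_square)
  also have "\<dots> = (a * tu * tw - k * a * b * X * tu) * (Dx * Dy * Du)"
    unfolding tu[symmetric] tw[symmetric] by (simp add: algebra_simps)
  finally have "(u * F) * (Dx * Dy * Du) =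
      (h * F' + a * tu * tw - k * a * b * X * tu) * (Dx * Dy * Du)"
    by (simp add: algebra_simps)
  then show ?thesis using nz by simp
qed

lemma one_minus_fps_exp_nonzero:
  assumes "c \<noteq> 0"
  shows "1 - fps_exp c \<noteq> (0 :: complex fps)"
proof
  assume "1 - fps_exp c = (0 :: complex fps)"
  then have "(1 - fps_exp c) $ 1 = (0 :: complex fps) $ 1" by (simp only:)
  then show False using assms by simp
qed

text \<open>The summands are the cone of index p spanned by (q, 0) and (1, p), the unimodular cone
  spanned by (1, p) and (0, q), and a correction for their common ray, which both count.\<close>

lemma Td_at_recurrence:
  fixes p q :: int
  assumes pq: "0 < p" "p < q" and nz: "x \<noteq> 0" "y \<noteq> 0" "x + of_int p * y \<noteq> 0"
  defines "u \<equiv> x + of_int p * y"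
  shows "fps_const u * Td_at p q x y =
      fps_const (of_int p * y) * Td_at (- q) p (of_int q * x / of_int p) (u / of_int p)
      + fps_const x * todd_at 1 u * todd_at 1 (of_int q * y)
      - fps_const (of_int q) * fps_const x * fps_const y * fps_X * todd_at 1 u"
proof (rule subdivision_algebra)
  let ?X = "of_int q * x / of_int p" and ?Y = "u / of_int p"
  show "Td_at p q x y * (1 - fps_exp (- (of_int q * x))) * (1 - fps_exp (- (of_int q * y))) =
      fps_const (of_int q) * fps_const x * fps_const y * fps_X ^ 2 * box_sum p q x y"
    using Td_at_mult[of q p x y] pq by simp
  show "Td_at (- q) p ?X ?Y * (1 - fps_exp (- (of_int q * x))) * (1 - fps_exp (- u)) =
      fps_const (of_int p * ?X * ?Y) * fps_X ^ 2 * box_sum (- q) p ?X ?Y"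
    using Td_at_mult[of p "- q" ?X ?Y] pq by simp
  show "box_sum p q x y * (1 - fps_exp (- u)) = box_sum (- q) p ?X ?Y * (1 - fps_exp (- (of_int q * y)))
      + (1 - fps_exp (- (of_int q * x))) * (1 - (1 - fps_exp (- (of_int q * y))))"
    unfolding u_def using box_sum_subdivide[OF pq, of x y] by simp
  show "todd_at 1 u * (1 - fps_exp (- u)) = fps_const u * fps_X"
    using todd_at_mult[of 1 u] by simp
  show "todd_at 1 (of_int q * y) * (1 - fps_exp (- (of_int q * y))) =
      fps_const (of_int q) * fps_const y * fps_X"
    using todd_at_mult[of 1 "of_int q * y"] by simp
  show "fps_const (of_int p * y) * fps_const (of_int p * ?X * ?Y) =
      fps_const u * fps_const (of_int q) * fps_const x * fps_const y"
    using pq by (simp add: field_simps)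
  show "1 - fps_exp (- (of_int q * x)) \<noteq> 0" "1 - fps_exp (- (of_int q * y)) \<noteq> 0"
    "1 - fps_exp (- u) \<noteq> 0"
    using pq nz unfolding u_def[symmetric] by (intro one_minus_fps_exp_nonzero; simp)+
qed

section \<open>Coefficients of degree N and their congruences\<close>

lemma nth_Td_at_recurrence:
  fixes p q :: int
  assumes pq: "0 < p" "p < q" and nz: "x \<noteq> 0" "y \<noteq> 0" "x + of_int p * y \<noteq> 0" and N: "N > 0"
  defines "u \<equiv> x + of_int p * y"
  shows "u * Td_at p q x y $ N =
      of_int p * y * Td_at (- q) p (of_int q * x / of_int p) (u / of_int p) $ N
      + x * (todd_at 1 u * todd_at 1 (of_int q * y)) $ N
      - of_int q * x * y * (u ^ (N - 1) * todd_factor 1 $ (N - 1))"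
proof -
  have "(fps_const u * Td_at p q x y) $ N =
      (fps_const (of_int p * y) * Td_at (- q) p (of_int q * x / of_int p) (u / of_int p)
      + fps_const x * (todd_at 1 u * todd_at 1 (of_int q * y))
      - fps_const (of_int q * x * y) * (fps_X * todd_at 1 u)) $ N"
    using Td_at_recurrence[OF pq nz] by (simp add: u_def mult.assoc flip: fps_const_mult)
  then show ?thesis
    using N by (simp add: nth_todd_at del: fps_const_mult)
qed

text \<open>The extreme terms of the convolution carry B_N and give the pure powers; every mixed
  term contains u w, with integral coefficient by \<open>todd_coeff_integral\<close>.\<close>

lemma nth_todd_product:
  assumes "even N" "N > 0"
  shows "\<exists>J\<in>int_poly_fun. \<forall>u w. fact N * of_int (bern_den N * bern_lcm N) * (todd_at 1 u * todd_at 1 w) $ N =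
           of_int (bern_num N * bern_lcm N) * (u ^ N + w ^ N) + u * w * J u w"
proof -
  define C where "C = (fact N * of_int (bern_den N * bern_lcm N) :: complex)"
  define b where "b = (\<lambda>i. todd_factor 1 $ i)"
  define e where "e = (\<lambda>i. C * b i * b (N - i))"
  define J where "J = (\<lambda>u w. \<Sum>i\<in>{1..<N}. e i * u ^ (i - 1) * w ^ (N - i - 1))"
  have "J \<in> int_poly_fun" unfolding J_def
  proof (intro int_poly_fun_intros)
    fix i assume "i \<in> {1..<N}"
    then show "e i \<in> \<int>"
      using todd_coeff_integral[of N i] assms by (simp add: C_def b_def e_def)
  qed
  moreover have "C * (todd_at 1 u * todd_at 1 w) $ N =
      of_int (bern_num N * bern_lcm N) * (u ^ N + w ^ N) + u * w * J u w" for u w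
  proof -
    have b0: "b 0 = 1" by (simp add: b_def nth_todd_factor_1 bernoulli_0)
    have CN: "C * b N = of_int (bern_num N * bern_lcm N)"
      unfolding C_def b_def by (rule todd_coeff_top) fact
    have "C * (todd_at 1 u * todd_at 1 w) $ N = (\<Sum>i\<in>{0..N}. C * b i * b (N - i) * u ^ i * w ^ (N - i))"
      by (simp add: fps_mult_nth nth_todd_at b_def sum_distrib_left mult_ac)
    also have "{0..N} = insert 0 (insert N {1..<N})" using assms by auto
    also have "(\<Sum>i\<in>insert 0 (insert N {1..<N}). C * b i * b (N - i) * u ^ i * w ^ (N - i)) =
        C * b N * (u ^ N + w ^ N) + (\<Sum>i\<in>{1..<N}. C * b i * b (N - i) * u ^ i * w ^ (N - i))"
      using assms by (simp add: b0 algebra_simps)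
    also have "(\<Sum>i\<in>{1..<N}. C * b i * b (N - i) * u ^ i * w ^ (N - i)) = u * w * J u w"
      unfolding J_def e_def sum_distrib_left
    proof (intro sum.cong refl)
      fix i assume "i \<in> {1..<N}"
      then have "u ^ i = u * u ^ (i - 1)" "w ^ (N - i) = w * w ^ (N - i - 1)"
        using power_minus_mult[of i u] power_minus_mult[of "N - i" w] by (auto simp: mult.commute)
      then show "C * b i * b (N - i) * u ^ i * w ^ (N - i) =
          u * w * (C * b i * b (N - i) * u ^ (i - 1) * w ^ (N - i - 1))"
        by (simp only: mult_ac)
    qed
    finally show ?thesis by (simp only: CN)
  qed
  ultimately show ?thesis unfolding C_def by blast
qed

text \<open>The error term is an integer polynomial in \<open>x + p y\<close> and \<open>q y\<close>, which span the lattice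
  shared by the cone and all its subdivisions; this is what makes the statement inductive. The
  condition \<open>Im (x * cnj y) \<noteq> 0\<close> says that \<open>x, y\<close> are linearly independent over the reals, so no
  linear form met along the way vanishes.\<close>

definition todd_congruence :: "nat \<Rightarrow> int \<Rightarrow> int \<Rightarrow> int \<Rightarrow> bool" where
  "todd_congruence N p q p' \<longleftrightarrow> (\<exists>J\<in>int_poly_fun. \<forall>x y. Im (x * cnj y) \<noteq> 0 \<longrightarrow>
     fact N * of_int (bern_den N * bern_lcm N) * Td_at p q x y $ N =
     of_int (bern_num N * bern_lcm N)
       * (x * (x + of_int p * y) ^ (N - 1) + y * (of_int p' * x + y) ^ (N - 1))
     + of_int q * x * y * J (x + of_int p * y) (of_int q * y))"

lemma root_char_periodic:
  assumes "q > 0" "q dvd m - n"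
  shows "root_char q m = root_char q n"
  using root_char_add[of q n "m - n"] root_char_eq_1_iff[of q "m - n"] assms by simp

text \<open>The series depends on p only modulo q, while x + p y changes by k times q y; the
  resulting change of the power is absorbed into the error term.\<close>

lemma todd_congruence_shift:
  assumes "q > 0" "todd_congruence N p q p'"
  shows "todd_congruence N (p + k * q) q p'"
proof -
  have Td: "Td_at (p + k * q) q x y = Td_at p q x y" for x y
    unfolding Td_at_def
    by (intro sum.cong refl arg_cong2[where f = "(*)"] arg_cong2[where f = todd_at]
        root_char_periodic assms) (simp add: algebra_simps)
  define A where "A = (of_int (bern_num N * bern_lcm N) :: complex)"
  obtain J where J: "J \<in> int_poly_fun" and eq: "\<And>x y. Im (x * cnj y) \<noteq> 0 \<Longrightarrow>
     fact N * of_int (bern_den N * bern_lcm N) * Td_at p q x y $ N =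
     A * (x * (x + of_int p * y) ^ (N - 1) + y * (of_int p' * x + y) ^ (N - 1))
     + of_int q * x * y * J (x + of_int p * y) (of_int q * y)"
    using assms(2) unfolding todd_congruence_def A_def by blast
  have "(\<lambda>u _. u) \<in> int_poly_fun" "(\<lambda>_ w. of_int (- k) * w) \<in> int_poly_fun"
    by (intro int_poly_fun_intros)+
  then obtain h where h: "h \<in> int_poly_fun"
    "\<And>u w. (u + of_int (- k) * w) ^ (N - 1) = u ^ (N - 1) + of_int (- k) * w * h u w"
    using int_poly_fun_power_diff[of "\<lambda>u _. u" "\<lambda>_ w. of_int (- k) * w"] by metis
  define J' where "J' = (\<lambda>u w. J (u + of_int (- k) * w) w + A * of_int (- k) * h u w)"
  have "(\<lambda>u w. J (u + of_int (- k) * w) w) \<in> int_poly_fun"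
    by (rule int_poly_fun_subst[OF J]) (intro int_poly_fun_intros)+
  then have "J' \<in> int_poly_fun" unfolding J'_def A_def by (intro int_poly_fun_intros h)
  moreover have "fact N * of_int (bern_den N * bern_lcm N) * Td_at (p + k * q) q x y $ N =
     A * (x * (x + of_int (p + k * q) * y) ^ (N - 1) + y * (of_int p' * x + y) ^ (N - 1))
     + of_int q * x * y * J' (x + of_int (p + k * q) * y) (of_int q * y)" if "Im (x * cnj y) \<noteq> 0" for x y
  proof -
    define u where "u = x + of_int (p + k * q) * y"
    define w where "w = of_int q * y"
    have u: "x + of_int p * y = u + of_int (- k) * w" by (simp add: u_def w_def algebra_simps)
    show ?thesis
      unfolding Td eq[OF that] u h(2) J'_def u_def[symmetric] w_def[symmetric]
      by (simp add: w_def algebra_simps)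
  qed
  ultimately show ?thesis unfolding todd_congruence_def A_def by blast
qed

text \<open>Every integer is an inverse modulo 1. Passing from y to p' x + y inside the power costs
  a multiple of x, and the outer factor y completes it to an admissible error.\<close>

lemma todd_congruence_unimodular:
  assumes "even N" "N > 0"
  shows "todd_congruence N 0 1 p'"
proof -
  define A where "A = (of_int (bern_num N * bern_lcm N) :: complex)"
  obtain J where J: "J \<in> int_poly_fun" and eq: "\<And>u w.
      fact N * of_int (bern_den N * bern_lcm N) * (todd_at 1 u * todd_at 1 w) $ N =
      A * (u ^ N + w ^ N) + u * w * J u w"
    using nth_todd_product[OF assms] unfolding A_def by blast
  have "(\<lambda>_ w. w) \<in> int_poly_fun" "(\<lambda>u _. of_int p' * u) \<in> int_poly_fun"
    by (intro int_poly_fun_intros)+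
  then obtain h where h: "h \<in> int_poly_fun"
    "\<And>u w. (w + of_int p' * u) ^ (N - 1) = w ^ (N - 1) + of_int p' * u * h u w"
    using int_poly_fun_power_diff[of "\<lambda>_ w. w" "\<lambda>u _. of_int p' * u"] by metis
  define J' where "J' = (\<lambda>u w. J u w - A * of_int p' * h u w)"
  have "J' \<in> int_poly_fun" unfolding J'_def A_def by (intro int_poly_fun_intros h J)
  moreover have "fact N * of_int (bern_den N * bern_lcm N) * Td_at 0 1 x y $ N =
     A * (x * (x + of_int 0 * y) ^ (N - 1) + y * (of_int p' * x + y) ^ (N - 1))
     + of_int 1 * x * y * J' (x + of_int 0 * y) (of_int 1 * y)" for x y
  proof -
    have "{0..<1 :: int} = {0}" by auto
    then have Td: "Td_at 0 1 x y = todd_at 1 x * todd_at 1 y"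
      using root_char_eq_1_iff[of 1 0] by (simp add: Td_at_def)
    have pow: "x ^ N = x * x ^ (N - 1)" "y ^ N = y * y ^ (N - 1)"
      using assms by (simp_all flip: power_Suc)
    show ?thesis
      unfolding Td eq pow J'_def using h(2)[of y x] by (simp add: algebra_simps)
  qed
  ultimately show ?thesis unfolding todd_congruence_def A_def by blast
qed

text \<open>By \<open>d\<close>, the integer \<open>- d\<close> is inverse to \<open>- q\<close>
  modulo \<open>p\<close>, so \<open>sub\<close> describes the smaller cone. Its term in p' x + y is
  the required one, its term in q y cancels against the unimodular piece, and the rest is divisible
  by u = x + p y.\<close>

lemma todd_congruence_subdivide:
  fixes p q p' d :: int
  assumes N: "even N" "N > 0" and pq: "0 < p" "p < q" and d: "q * d = 1 - p * p'"
    and sub: "todd_congruence N (- q) p (- d)"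
  shows "todd_congruence N p q p'"
proof -
  define A where "A = (of_int (bern_num N * bern_lcm N) :: complex)"
  define C where "C = (fact N * of_int (bern_den N * bern_lcm N) :: complex)"
  define c where "c = C * todd_factor 1 $ (N - 1)"
  obtain J0 where J0: "J0 \<in> int_poly_fun" and eq0: "\<And>u w.
      C * (todd_at 1 u * todd_at 1 w) $ N = A * (u ^ N + w ^ N) + u * w * J0 u w"
    using nth_todd_product[OF N] unfolding A_def C_def by blast
  obtain J1 where J1: "J1 \<in> int_poly_fun" and eq1: "\<And>x y. Im (x * cnj y) \<noteq> 0 \<Longrightarrow>
     C * Td_at (- q) p x y $ N =
     A * (x * (x + of_int (- q) * y) ^ (N - 1) + y * (of_int (- d) * x + y) ^ (N - 1))
     + of_int p * x * y * J1 (x + of_int (- q) * y) (of_int p * y)"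
    using sub unfolding todd_congruence_def A_def C_def by blast
  have c: "c \<in> \<int>" using todd_coeff_pred_integral[OF N] by (simp add: c_def C_def)
  \<comment> \<open>The arguments of \<open>J1\<close> come from X - q Y = -w and p Y = u. The last
    summand is the correction for the common ray, after cancelling one factor u.\<close>
  define J where "J = (\<lambda>u w. J1 (- w) u + J0 u w - c * u ^ (N - 2))"
  have "(\<lambda>u w. J1 (- w) u) \<in> int_poly_fun"
    by (rule int_poly_fun_subst[OF J1]) (intro int_poly_fun_intros)+
  then have "J \<in> int_poly_fun" unfolding J_def by (intro int_poly_fun_intros J0 c)
  moreover have "C * Td_at p q x y $ N =
     A * (x * (x + of_int p * y) ^ (N - 1) + y * (of_int p' * x + y) ^ (N - 1))
     + of_int q * x * y * J (x + of_int p * y) (of_int q * y)" if xy: "Im (x * cnj y) \<noteq> 0" for x y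
  proof -
    define u where "u = x + of_int p * y"
    define w where "w = of_int q * y"
    define v where "v = of_int p' * x + y"
    define X where "X = of_int q * x / of_int p"
    define Y where "Y = u / of_int p"
    have nz: "x \<noteq> 0" "y \<noteq> 0" using xy by auto
    have p0: "(of_int p :: complex) \<noteq> 0" using pq by simp
    have u0: "u \<noteq> 0"
    proof
      assume "u = 0"
      then have "x = - of_int p * y" by (simp add: u_def add_eq_0_iff)
      then show False using xy by (simp add: algebra_simps)
    qed
    \<comment> \<open>Real scaling and passing from (x, y) to (x, u) preserve linear independence
      over the reals.\<close>
    have "X * cnj Y = of_real (of_int q / (of_int p)\<^sup>2) * (x * cnj u)"
      by (simp add: X_def Y_def power2_eq_square)
    then have "Im (X * cnj Y) = of_int q / (of_int p)\<^sup>2 * Im (x * cnj u)"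
      by simp
    moreover have "Im (x * cnj u) = of_int p * Im (x * cnj y)"
      by (simp add: u_def algebra_simps)
    ultimately have XY: "Im (X * cnj Y) \<noteq> 0" using xy pq by simp
    have qd: "of_int q * of_int d = (1 - of_int p * of_int p' :: complex)"
      using arg_cong[OF d, of "of_int :: int \<Rightarrow> complex"] by simp
    have e1: "X + of_int (- q) * Y = - w"
      using p0 by (simp add: X_def Y_def u_def w_def field_simps)
    have e2: "of_int p * Y = u" using p0 by (simp add: Y_def)
    \<comment> \<open>The Bezout relation turns -q d x + u into p (p' x + y).\<close>
    have "of_int p * (of_int (- d) * X + Y) = - (of_int q * of_int d) * x + u"
      using p0 by (simp add: X_def Y_def field_simps)
    also have "\<dots> = of_int p * v" unfolding qd by (simp add: u_def v_def algebra_simps)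
    finally have e3: "of_int (- d) * X + Y = v" using p0 by simp
    have e4: "of_int p * y * X = w * x" using p0 by (simp add: X_def w_def)
    \<comment> \<open>This sign makes the term -x w^N of the smaller cone cancel x w^N of the
      unimodular one.\<close>
    have odd: "(- w) ^ (N - 1) = - (w ^ (N - 1))" using N by (simp add: power_minus_odd)
    have pow: "u ^ N = u * u ^ (N - 1)" "w ^ N = w * w ^ (N - 1)" "u ^ (N - 1) = u * u ^ (N - 2)"
    proof -
      have "N - 1 > 0" "N - 1 - 1 = N - 2" using N by auto
      then show "u ^ N = u * u ^ (N - 1)" "w ^ N = w * w ^ (N - 1)" "u ^ (N - 1) = u * u ^ (N - 2)"
        using N power_minus_mult[of N u] power_minus_mult[of N w] power_minus_mult[of "N - 1" u]
        by (simp_all add: mult.commute)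
    qed
    have "u * (C * Td_at p q x y $ N) = C * (u * Td_at p q x y $ N)" by (simp only: mult_ac)
    also have "u * Td_at p q x y $ N = of_int p * y * Td_at (- q) p X Y $ N
        + x * (todd_at 1 u * todd_at 1 w) $ N - w * x * (u ^ (N - 1) * todd_factor 1 $ (N - 1))"
      using nth_Td_at_recurrence[OF pq nz, of N] u0 N(2) unfolding u_def[symmetric]
      by (simp add: X_def Y_def w_def mult_ac)
    also have "C * \<dots> = of_int p * y * (C * Td_at (- q) p X Y $ N)
        + x * (C * (todd_at 1 u * todd_at 1 w) $ N) - w * x * (c * u ^ (N - 1))"
      by (simp add: c_def algebra_simps)
    also have "\<dots> = A * ((of_int p * y * X) * - (w ^ (N - 1)) + y * (of_int p * Y) * v ^ (N - 1))
        + (of_int p * y * X) * (of_int p * Y) * J1 (- w) u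
        + x * (A * (u ^ N + w ^ N) + u * w * J0 u w) - w * x * (c * u ^ (N - 1))"
      unfolding eq1[OF XY] eq0 e1 e3 odd e2 by (simp add: algebra_simps e2[symmetric])
    also have "\<dots> = u * (A * (x * u ^ (N - 1) + y * v ^ (N - 1)) + w * x * J u w)"
      unfolding e2 e4 J_def pow by (simp add: algebra_simps)
    finally have "C * Td_at p q x y $ N = A * (x * u ^ (N - 1) + y * v ^ (N - 1)) + w * x * J u w"
      using u0 by simp
    then show ?thesis by (simp add: u_def v_def w_def mult_ac)
  qed
  ultimately show ?thesis unfolding todd_congruence_def A_def C_def by blast
qed

text \<open>This is the Euclidean algorithm: p is reduced to r modulo q, and then (r, q) is replaced
  by (-q, r). By the Bezout relation, r = 0 forces q = 1.\<close>

lemma todd_congruence_all: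
  fixes p q p' d :: int
  assumes N: "even N" "N > 0" and "q > 0" and "q * d = 1 - p * p'"
  shows "todd_congruence N p q p'"
  using assms(3,4)
proof (induction "nat q" arbitrary: p q p' d rule: less_induct)
  case less
  define r where "r = p mod q"
  define k where "k = p div q"
  have p: "p = r + k * q" by (simp add: r_def k_def)
  have r: "0 \<le> r" "r < q" using less.prems by (auto simp: r_def)
  \<comment> \<open>The cofactor is adjusted so that the relation holds for \<open>r\<close> with
    the same \<open>p'\<close>.\<close>
  define e where "e = d + k * p'"
  have e: "q * e = 1 - r * p'" using less.prems(2) by (simp add: e_def p algebra_simps)
  have "todd_congruence N r q p'"
  proof (cases "r = 0")
    case True
    then have "q * e = 1" using e by simp
    then have "q = 1" using less.prems(1) by (simp add: zmult_eq_1_iff)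
    then show ?thesis using True todd_congruence_unimodular[OF N] by simp
  next
    case False
    then have "nat r < nat q" "r > 0" using r by auto
    \<comment> \<open>The same relation, now with \<open>p'\<close> as the cofactor and
      \<open>- e\<close> as the inverse modulo \<open>r\<close>.\<close>
    moreover have "r * p' = 1 - (- q) * (- e)" using e by simp
    ultimately have "todd_congruence N (- q) r (- e)" using less.hyps by blast
    then show ?thesis using todd_congruence_subdivide[OF N _ r(2) e] \<open>r > 0\<close> by blast
  qed
  then show ?case using todd_congruence_shift[OF less.prems(1)] p by metis
qed

theorem theorem5p1:
  fixes N n :: nat and p q :: int and as :: "int list" and ps qs :: "nat \<Rightarrow> int"
  assumes "even N" and "N > 0"
    and "0 < p" and "p < q" and "coprime p q"
    and "n = length as" and "n \<ge> 1" and "\<forall>a\<in>set as. a \<ge> 1"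
    and "(of_int q / of_int p :: rat) = cont_frac as"
    and "ps 0 = 0" and "qs 0 = 1"
    and "\<forall>k\<in>{1..n}. ps k > 0 \<and> qs k > 0 \<and> coprime (ps k) (qs k) \<and>
           (of_int (qs k) / of_int (ps k) :: rat) = cont_frac (take k as)"
  shows "of_int (fact N * bern_den N * bern_lcm N) * homogeneous_part N (Td p q)
           - of_int (bern_num N * bern_lcm N) * (var_x + of_int p * var_y) ^ (N - 1) * var_x
           - of_int (bern_num N * bern_lcm N)
               * (of_int ((-1) ^ (n - 1) * qs (n - 1)) * var_x + var_y) ^ (N - 1) * var_y
         \<in> {of_int q * P | P. P \<in> int_polys_xy}"
    (is "?L \<in> _")
proof -
  have ne: "as \<noteq> []" using assms(6,7) by auto
  have cf: "cf_num_den as = (q, p)"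
    using convergent_eq_cf_num_den[OF assms(8) ne assms(3,5,9)] .
  have cf': "cf_num_den (butlast as) = (qs (n - 1), ps (n - 1))"
  proof (cases "n = 1")
    case True
    then have "butlast as = []" using assms(6) by (cases as) auto
    then show ?thesis using True assms(10,11) by simp
  next
    case False
    then have "n - 1 \<in> {1..n}" "butlast as = take (n - 1) as" "butlast as \<noteq> []"
      using assms(6,7) by (auto simp: butlast_conv_take simp flip: length_0_conv)
    then show ?thesis
      using assms(8,12) by (intro convergent_eq_cf_num_den) (auto dest: in_set_takeD)
  qed
  \<comment> \<open>By the determinant identity this is inverse to p modulo q, and
    \<open>ps (n - 1)\<close> supplies the cofactor up to sign.\<close>
  define p' where "p' = (-1) ^ (n - 1) * qs (n - 1)"
  have "q * ps (n - 1) - p * qs (n - 1) = (-1) ^ n"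
    using cf_num_den_det[OF ne] by (simp add: cf cf' assms(6))
  also have "\<dots> = - ((-1) ^ (n - 1))"
    using assms(7) by (cases n) auto
  finally have "p * qs (n - 1) - q * ps (n - 1) = (-1) ^ (n - 1)" by simp
  then have "(-1) ^ (n - 1) * (p * qs (n - 1) - q * ps (n - 1)) = (-1) ^ (n - 1) * (-1) ^ (n - 1)"
    by (simp only:)
  then have "q * (- ((-1) ^ (n - 1) * ps (n - 1))) = 1 - p * p'"
    by (simp add: p'_def algebra_simps flip: power_mult_distrib)
  then have "todd_congruence N p q p'"
    by (rule todd_congruence_all[OF assms(1,2), rotated]) (use assms(3,4) in simp)
  then obtain J where J: "J \<in> int_poly_fun" and eq: "\<And>x y. Im (x * cnj y) \<noteq> 0 \<Longrightarrow>
     fact N * of_int (bern_den N * bern_lcm N) * Td_at p q x y $ N =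
     of_int (bern_num N * bern_lcm N)
       * (x * (x + of_int p * y) ^ (N - 1) + y * (of_int p' * x + y) ^ (N - 1))
     + of_int q * x * y * J (x + of_int p * y) (of_int q * y)"
    unfolding todd_congruence_def by blast
  have "(\<lambda>x y. x * y * J (x + of_int p * y) (of_int q * y)) \<in> int_poly_fun"
    by (intro int_poly_fun_intros int_poly_fun_subst[OF J])
  then obtain P where P: "P \<in> int_polys_xy"
    "\<And>x y. eval_xy P x y = x * y * J (x + of_int p * y) (of_int q * y)"
    using int_poly_fun_imp_int_polys_xy by blast
  have "?L = of_int q * P"
  \<comment> \<open>The congruence is available only for x, y independent over the reals, and such
    pairs determine a polynomial.\<close>
  proof (rule poly_xy_eqI)
    fix x y :: complex assume xy: "Im (x * cnj y) \<noteq> 0"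
    have "eval_xy (homogeneous_part N (Td p q)) x y = Td_at p q x y $ N"
      using assms by (simp add: eval_xy_homogeneous_part nth_Td_at)
    then show "eval_xy ?L x y = eval_xy (of_int q * P) x y"
      using eq[OF xy] unfolding eval_xy_simps P(2) p'_def[symmetric]
      by (simp add: algebra_simps)
  qed
  then show ?thesis using P(1) by blast
qed

end
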